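(* Let $v$ and $\phi$ be real analytic functions from an interval $I\subset\mathbb R$ (containing $0$) into $\mathbb R$, with $v(t)>0$. Let $N$ be the harmonic map into $\mathbb S^2$ given via the DPW method by the potential $$\xi(z)=\frac14\begin{pmatrix}2\kappa_3 i&(\kappa_2-1-\kappa_1i)\lambda^{-1}+(\kappa_2+1-\kappa_1i)\lambda\\(-\kappa_2-1-\kappa_1i)\lambda^{-1}+(1-\kappa_2-\kappa_1i)\lambda&-2\kappa_3i\end{pmatrix}dz,$$ where $\kappa_1,\kappa_2,\kappa_3$ are the holomorphic extensions of the functions $$\kappa_1(x)=-v(x)\cos\phi(x),\qquad \kappa_2(x)=-v(x)\sin\phi(x),\qquad \kappa_3(x)=-\phi'(x).$$ Then $N$ maps the real line (that is, $I\times\{0\}$) into a great circle. If the potential is integrated with the initial condition (at $z=0$) $$R_0=\frac1{\sqrt2}\begin{pmatrix}e^{-i\alpha}&\lambda e^{i\alpha}\\-\lambda^{-1}e^{-i\alpha}&e^{i\alpha}\end{pmatrix},\qquad \alpha=\frac{\phi(0)}2,$$ then this great circle lies in the plane perpendicular to $E_3$.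
   Context: $\mathbb R^3$ is identified with $\mathfrak{su}(2)$ via the orthonormal basis $E_1=\frac12\begin{pmatrix}0&-i\\-i&0\end{pmatrix}$, $E_2=\frac12\begin{pmatrix}0&1\\-1&0\end{pmatrix}$, $E_3=\frac12\begin{pmatrix}i&0\\0&-i\end{pmatrix}$ (the Lie bracket is then the cross product), and $\mathbb S^2$ is the unit sphere; $z=x+iy$. DPW method: $\Lambda SU(2)_\sigma$ is the group of loops $F(\lambda)$, $\lambda\in\mathbb S^1$, in $SU(2)$ with diagonal entries even and off-diagonal entries odd in $\lambda$; $\Lambda SL(2,\mathbb C)_\sigma$ is defined in the same way with values in $SL(2,\mathbb C)$; $\Lambda^+SL(2,\mathbb C)_\sigma$ is the subgroup of loops that extend holomorphically in $\lambda$ to the unit disc. Given a holomorphic potential $\xi$ on a simply connected neighbourhood of $I$ in $\mathbb C$, one solves $d\Phi=\Phi\xi$ with an initial condition $\Phi(0)\in\Lambda SU(2)_\sigma$ (for example the identity), takes the pointwise Iwasawa decomposition $\Phi=FB_+$ with $F\in\Lambda SU(2)_\sigma$, $B_+\in\Lambda^+SL(2,\mathbb C)_\sigma$, and obtains the harmonic map $N=\mathrm{Ad}_FE_3|_{\lambda=1}$. *)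

theory Defs
  imports "HOL-Complex_Analysis.Complex_Analysis"
begin

text \<open>The radius may depend on the centre; at an endpoint of \<open>I\<close> that belongs to \<open>I\<close> the series
  is only compared with \<open>f\<close> on one side, so \<open>f\<close> extends analytically across it.\<close>

definition real_analytic_on :: "(real \<Rightarrow> real) \<Rightarrow> real set \<Rightarrow> bool" where
  "real_analytic_on f I \<longleftrightarrow>
     (\<forall>x\<in>I. \<exists>r>0. \<exists>a. \<forall>y\<in>I. \<bar>y - x\<bar> < r \<longrightarrow> (\<lambda>n. a n * (y - x) ^ n) sums f y)"

type_synonym cmat2 = "complex^2^2"

definition mat2 :: "complex \<Rightarrow> complex \<Rightarrow> complex \<Rightarrow> complex \<Rightarrow> cmat2" where
  "mat2 a b c d = vector [vector [a, b], vector [c, d]]"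

definition adjoint_mat :: "cmat2 \<Rightarrow> cmat2" where
  "adjoint_mat A = (\<chi> i j. cnj (A $ j $ i))"

definition SL2C :: "cmat2 set" where
  "SL2C = {A. det A = 1}"

definition SU2 :: "cmat2 set" where
  "SU2 = {A. A ** adjoint_mat A = mat 1 \<and> det A = 1}"

definition Ad :: "cmat2 \<Rightarrow> cmat2 \<Rightarrow> cmat2" where
  "Ad A X = A ** X ** matrix_inv A"

definition E1 :: cmat2 where "E1 = mat2 0 (-\<i>/2) (-\<i>/2) 0"
definition E2 :: cmat2 where "E2 = mat2 0 (1/2) (-1/2) 0"
definition E3 :: cmat2 where "E3 = mat2 (\<i>/2) 0 0 (-\<i>/2)"

text \<open>The identification of \<open>\<real>\<^sup>3\<close> with su(2). It sends the standard basis to \<open>E1, E2, E3\<close>, so these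
  are orthonormal for the transported inner product.\<close>

definition su2 :: "real^3 \<Rightarrow> cmat2" where
  "su2 p = (p $ 1) *\<^sub>R E1 + (p $ 2) *\<^sub>R E2 + (p $ 3) *\<^sub>R E3"

definition great_circle :: "(real^3) set \<Rightarrow> bool" where
  "great_circle C \<longleftrightarrow> (\<exists>n. n \<noteq> 0 \<and> C = {p \<in> sphere 0 1. n \<bullet> p = 0})"

text \<open>The loop parameter is written \<open>\<zeta>\<close>. Loops are represented by functions on \<open>\<complex>\<close> of which only the values on the unit circle
  matter. They are taken to be continuous, the weakest regularity for which a holomorphic
  extension to the disc has boundary values on the whole circle.\<close>

definition twisted :: "(complex \<Rightarrow> cmat2) \<Rightarrow> bool" where
  "twisted X \<longleftrightarrow> (\<forall>\<zeta>\<in>sphere 0 1. \<forall>i j.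
     X (-\<zeta>) $ i $ j = (if i = j then X \<zeta> $ i $ j else - (X \<zeta> $ i $ j)))"

definition loop_SL2 :: "(complex \<Rightarrow> cmat2) set" where
  "loop_SL2 = {X. continuous_on (sphere 0 1) X \<and> twisted X \<and> (\<forall>\<zeta>\<in>sphere 0 1. X \<zeta> \<in> SL2C)}"

definition loop_SU2 :: "(complex \<Rightarrow> cmat2) set" where
  "loop_SU2 = {X. continuous_on (sphere 0 1) X \<and> twisted X \<and> (\<forall>\<zeta>\<in>sphere 0 1. X \<zeta> \<in> SU2)}"

definition loop_plus_SL2 :: "(complex \<Rightarrow> cmat2) set" where
  "loop_plus_SL2 = {X \<in> loop_SL2. \<exists>G. continuous_on (cball 0 1) G
     \<and> (\<forall>i j. (\<lambda>\<zeta>. G \<zeta> $ i $ j) holomorphic_on ball 0 1)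
     \<and> (\<forall>\<zeta>\<in>sphere 0 1. G \<zeta> = X \<zeta>)}"

definition iwasawa_decomposition ::
    "(complex \<Rightarrow> cmat2) \<Rightarrow> (complex \<Rightarrow> cmat2) \<Rightarrow> (complex \<Rightarrow> cmat2) \<Rightarrow> bool" where
  "iwasawa_decomposition X F B \<longleftrightarrow>
     F \<in> loop_SU2 \<and> B \<in> loop_plus_SL2 \<and> (\<forall>\<zeta>\<in>sphere 0 1. X \<zeta> = F \<zeta> ** B \<zeta>)"

text \<open>A potential \<open>\<xi> = A dz\<close> is given by its coefficient \<open>A z \<zeta>\<close>, so that \<open>d\<Phi> = \<Phi> \<xi>\<close> reads
  \<open>d\<Phi>/dz = \<Phi> A\<close> entrywise, as a complex derivative.\<close>

definition solves_potential ::
    "complex set \<Rightarrow> (complex \<Rightarrow> complex \<Rightarrow> cmat2) \<Rightarrow> (complex \<Rightarrow> complex \<Rightarrow> cmat2) \<Rightarrow> bool" where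
  "solves_potential U A \<Phi> \<longleftrightarrow> (\<forall>\<zeta>\<in>sphere 0 1. \<forall>z\<in>U. \<forall>i j.
     ((\<lambda>w. \<Phi> w \<zeta> $ i $ j) has_field_derivative (\<Phi> z \<zeta> ** A z \<zeta>) $ i $ j) (at z))"

text \<open>The Iwasawa factors are unique up to a constant diagonal matrix in SU(2), which commutes
  with \<open>E3\<close>; hence \<open>N\<close> is determined on \<open>U\<close> by the potential and the initial condition \<open>\<Phi>0\<close>.\<close>

definition dpw_map ::
    "complex set \<Rightarrow> (complex \<Rightarrow> complex \<Rightarrow> cmat2) \<Rightarrow> (complex \<Rightarrow> cmat2) \<Rightarrow> (complex \<Rightarrow> real^3) \<Rightarrow> bool"
  where
  "dpw_map U A \<Phi>0 N \<longleftrightarrow> (\<exists>\<Phi> F B.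
     solves_potential U A \<Phi>
     \<and> (\<forall>\<zeta>\<in>sphere 0 1. \<Phi> 0 \<zeta> = \<Phi>0 \<zeta>)
     \<and> (\<forall>z\<in>U. iwasawa_decomposition (\<Phi> z) (F z) (B z))
     \<and> (\<forall>z\<in>U. su2 (N z) = Ad (F z 1) E3))"

definition potential ::
    "(complex \<Rightarrow> complex) \<Rightarrow> (complex \<Rightarrow> complex) \<Rightarrow> (complex \<Rightarrow> complex) \<Rightarrow> complex \<Rightarrow> complex \<Rightarrow> cmat2"
  where
  "potential \<kappa>1 \<kappa>2 \<kappa>3 z \<zeta> = mat2
     (1/4 * (2 * \<kappa>3 z * \<i>))
     (1/4 * ((\<kappa>2 z - 1 - \<kappa>1 z * \<i>) * inverse \<zeta> + (\<kappa>2 z + 1 - \<kappa>1 z * \<i>) * \<zeta>))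
     (1/4 * ((- \<kappa>2 z - 1 - \<kappa>1 z * \<i>) * inverse \<zeta> + (1 - \<kappa>2 z - \<kappa>1 z * \<i>) * \<zeta>))
     (1/4 * (- 2 * \<kappa>3 z * \<i>))"

definition R0 :: "real \<Rightarrow> complex \<Rightarrow> cmat2" where
  "R0 \<alpha> \<zeta> = (1 / sqrt 2) *\<^sub>R mat2
     (exp (-\<i> * of_real \<alpha>))                (\<zeta> * exp (\<i> * of_real \<alpha>))
     (- inverse \<zeta> * exp (-\<i> * of_real \<alpha>)) (exp (\<i> * of_real \<alpha>))"

end

theory Submission imports Defs begin

text \<open>On the real axis \<open>\<kappa>\<^sub>1, \<kappa>\<^sub>2, \<kappa>\<^sub>3\<close> are real, so there the coefficient \<open>A\<close> of the potential is
  skew-Hermitian for every unimodular \<open>\<zeta>\<close> (\<open>potential_skew_adjoint\<close>), and the solution \<open>\<Phi>\<close> of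
  \<open>\<Phi>' = \<Phi> A\<close> stays unitary because it starts in the unitary loop group. A unitary loop needs no
  Iwasawa factorisation: its positive factor is at once unitary on the circle and holomorphic in
  the disc, hence diagonal by the maximum principle and the twisting
  (\<open>unitary_plus_loop_diagonal\<close>). A diagonal unitary matrix commutes with \<open>E3\<close>, so over the real
  axis \<open>N = \<Phi> E3 \<Phi>\<^sup>*\<close> at \<open>\<zeta> = 1\<close> (\<open>iwasawa_of_unitary_loop\<close>).

  The normal of the great circle can be written down. Let \<open>X\<close> be the unit vector
  \<open>- cos \<phi> E1 - sin \<phi> E2\<close>, which is orthogonal to \<open>E3\<close>. At \<open>\<zeta> = 1\<close> the coefficient is
  \<open>A = - \<phi>' E3 + v X\<close>; the commutator of \<open>X\<close> with the second term vanishes, while the first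
  rotates the plane of \<open>E1\<close> and \<open>E2\<close> at the speed opposite to that of \<open>X\<close>. Therefore
  \<open>X' = X A - A X\<close>, which says that \<open>\<Phi> X \<Phi>\<^sup>*\<close> is constant (\<open>conjugate_by_frame_constant\<close>). This
  constant vector is orthogonal to \<open>\<Phi> E3 \<Phi>\<^sup>* = N\<close> throughout, and the initial condition \<open>R0\<close> is
  the one that turns \<open>X 0\<close> into \<open>E3\<close> (\<open>R0_equator_dir\<close>).\<close>

section \<open>Unitary matrices and su(2)\<close>

(* Reserve the dollar sign for vector components; power series coefficients use it too. *)
no_notation fps_nth (infixl \<open>$\<close> 75)

lemmas mat2_entries = vec_eq_iff forall_2 matrix_matrix_mult_def sum_2

lemma mat2_nth [simp]:
  "mat2 a b c d $ 1 $ 1 = a" "mat2 a b c d $ 1 $ 2 = b"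
  "mat2 a b c d $ 2 $ 1 = c" "mat2 a b c d $ 2 $ 2 = d"
  by (simp_all add: mat2_def)

lemma adjoint_mat_nth [simp]: "adjoint_mat A $ i $ j = cnj (A $ j $ i)"
  by (simp add: adjoint_mat_def)

lemma adjoint_mat_mult: "adjoint_mat (A ** B) = adjoint_mat B ** adjoint_mat A"
  by (simp add: mat2_entries mult.commute)

lemma adjoint_mat_adjoint_mat [simp]: "adjoint_mat (adjoint_mat A) = A"
  by (simp add: vec_eq_iff)

lemma unitary_left:
  fixes A :: cmat2
  assumes "A ** adjoint_mat A = mat 1"
  shows "adjoint_mat A ** A = mat 1"
  using assms by (simp add: matrix_left_right_inverse)

lemma matrix_inv_unitary:
  fixes A :: cmat2
  assumes "A ** adjoint_mat A = mat 1"
  shows "matrix_inv A = adjoint_mat A"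
proof -
  have inv: "A ** matrix_inv A = mat 1 \<and> matrix_inv A ** A = mat 1"
    unfolding matrix_inv_def by (rule someI) (use assms unitary_left in blast)
  have "matrix_inv A = matrix_inv A ** (A ** adjoint_mat A)"
    using assms by simp
  also have "\<dots> = adjoint_mat A"
    using inv by (simp add: matrix_mul_assoc)
  finally show ?thesis .
qed

text \<open>For determinant 1 the inverse is the cofactor matrix, and for a unitary matrix it is the
  adjoint; comparing the entries of the two gives both identities.\<close>

lemma SU2_entries:
  fixes A :: cmat2
  assumes "A \<in> SU2"
  shows "A $ 2 $ 2 = cnj (A $ 1 $ 1)" and "A $ 2 $ 1 = - cnj (A $ 1 $ 2)"
proof -
  let ?C = "mat2 (A $ 2 $ 2) (- (A $ 1 $ 2)) (- (A $ 2 $ 1)) (A $ 1 $ 1)"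
  have "A ** ?C = mat 1"
    using assms by (simp add: SU2_def mat2_entries mat_def det_2 algebra_simps)
  have "adjoint_mat A = adjoint_mat A ** (A ** ?C)"
    by (simp add: \<open>A ** ?C = mat 1\<close>)
  also have "\<dots> = ?C"
    using assms by (simp add: matrix_mul_assoc unitary_left SU2_def)
  finally have *: "adjoint_mat A = ?C" .
  show "A $ 2 $ 2 = cnj (A $ 1 $ 1)"
    using arg_cong[OF *, of "\<lambda>M. M $ 1 $ 1"] by simp
  show "A $ 2 $ 1 = - cnj (A $ 1 $ 2)"
    using arg_cong[OF *, of "\<lambda>M. cnj (M $ 1 $ 2)"] by simp
qed

lemma su2_mat2:
  "su2 p = mat2 (\<i>/2 * p $ 3) (- \<i>/2 * p $ 1 + 1/2 * p $ 2) (- \<i>/2 * p $ 1 - 1/2 * p $ 2) (- \<i>/2 * p $ 3)"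
  by (simp add: su2_def E1_def E2_def E3_def mat2_entries complex_eq_iff)

lemma su2_surj:
  assumes "adjoint_mat X = - X" and "trace X = 0"
  obtains p where "su2 p = X"
proof -
  define p :: "real^3" where
    "p = vector [- 2 * Im (X $ 1 $ 2), 2 * Re (X $ 1 $ 2), 2 * Im (X $ 1 $ 1)]"
  have "cnj (X $ 1 $ 1) = - (X $ 1 $ 1)" "cnj (X $ 1 $ 2) = - (X $ 2 $ 1)"
    using assms(1) by (simp_all add: vec_eq_iff forall_2)
  moreover have "X $ 2 $ 2 = - (X $ 1 $ 1)"
    using assms(2) by (simp add: trace_def sum_2 eq_neg_iff_add_eq_0 add.commute)
  ultimately have "su2 p = X"
    by (auto simp: su2_mat2 mat2_entries p_def complex_eq_iff)
  then show ?thesis by (rule that)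
qed

text \<open>Reduces orthogonality and length in \<open>\<real>\<^sup>3\<close> to traces, which conjugation preserves.\<close>

lemma inner_eq_trace_su2:
  "complex_of_real (p \<bullet> q) = - 2 * trace (su2 p ** su2 q)"
  by (simp add: su2_mat2 trace_def mat2_entries inner_vec_def sum_3 complex_eq_iff algebra_simps)

lemma trace_conjugate_mult:
  fixes R X Y :: cmat2
  assumes "R ** adjoint_mat R = mat 1"
  shows "trace ((R ** X ** adjoint_mat R) ** (R ** Y ** adjoint_mat R)) = trace (X ** Y)"
proof -
  have "(R ** X ** adjoint_mat R) ** (R ** Y ** adjoint_mat R)
      = R ** X ** (adjoint_mat R ** R) ** Y ** adjoint_mat R"
    by (simp only: matrix_mul_assoc)
  also have "\<dots> = R ** (X ** Y ** adjoint_mat R)"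
    by (simp add: unitary_left[OF assms] matrix_mul_assoc)
  also have "trace \<dots> = trace (X ** Y ** (adjoint_mat R ** R))"
    by (subst trace_mul_sym) (simp only: matrix_mul_assoc)
  finally show ?thesis
    by (simp add: unitary_left[OF assms])
qed

lemma adjoint_mat_conjugate:
  "adjoint_mat (R ** X ** adjoint_mat R) = R ** adjoint_mat X ** adjoint_mat R"
  by (simp add: adjoint_mat_mult matrix_mul_assoc)

lemma conjugate_uminus:
  fixes R X :: cmat2
  shows "R ** (- X) ** adjoint_mat R = - (R ** X ** adjoint_mat R)"
  by (simp add: mat2_entries algebra_simps)

section \<open>Loops on the circle\<close>

text \<open>If \<open>f\<close> is real on the frontier, then \<open>exp (\<i> f)\<close> and \<open>exp (- \<i> f)\<close> have modulus 1 there. The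
  maximum principle for both forces \<open>f\<close> to be real inside as well, and a set of real numbers is
  never open in the plane.\<close>

lemma holomorphic_real_on_frontier_imp_constant:
  assumes cont: "continuous_on (closure S) f" and holo: "f holomorphic_on S"
    and S: "open S" "connected S" "bounded S"
    and real: "\<And>z. z \<in> frontier S \<Longrightarrow> f z \<in> \<real>"
  shows "f constant_on closure S"
proof -
  (* |exp (\<i> f)| = exp (- Im f), so the two signs bound Im f from both sides. *)
  have norm_le: "norm (exp (c * f z)) \<le> 1" if "c = \<i> \<or> c = - \<i>" "z \<in> S" for c z
  proof (rule maximum_modulus_frontier[where f = "\<lambda>z. exp (c * f z)" and S = S])
    show "(\<lambda>z. exp (c * f z)) holomorphic_on interior S"
      using holo S(1) by (auto simp: interior_open intro!: holomorphic_intros)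
    show "continuous_on (closure S) (\<lambda>z. exp (c * f z))"
      by (intro continuous_intros cont)
    show "norm (exp (c * f w)) \<le> 1" if "w \<in> frontier S" for w
      using real[OF that] \<open>c = \<i> \<or> c = - \<i>\<close> by (auto simp: complex_is_Real_iff)
  qed (use S that in auto)
  have Im0: "Im (f z) = 0" if "z \<in> S" for z
    using norm_le[OF _ that, of \<i>] norm_le[OF _ that, of "- \<i>"] by simp
  have "f constant_on S"
  proof (rule ccontr)
    assume "\<not> f constant_on S"
    then have "open (f ` S)" "S \<noteq> {}"
      using open_mapping_thm[OF holo S(1,2) S(1)] by (auto simp: constant_on_def)
    then obtain z e where z: "z \<in> S" "e > 0" "ball (f z) e \<subseteq> f ` S"
      by (metis all_not_in_conv image_eqI open_contains_ball)
    (* A step in the imaginary direction stays in the open image but leaves the real line. *)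
    have "f z + \<i> * (e / 2) \<in> ball (f z) e"
      using z(2) by (simp add: dist_norm norm_mult)
    then obtain w where "w \<in> S" "f w = f z + \<i> * (e / 2)"
      using z(3) by auto
    then show False
      using Im0[of w] Im0[of z] z by simp
  qed
  then show ?thesis
    using cont by (rule constant_on_closureI)
qed

text \<open>For values in \<open>SU(2)\<close> the off-diagonal entries satisfy \<open>b\<^sub>2\<^sub>1 = - cnj b\<^sub>1\<^sub>2\<close>, so
  \<open>b\<^sub>1\<^sub>2 - b\<^sub>2\<^sub>1\<close> and \<open>\<i> (b\<^sub>1\<^sub>2 + b\<^sub>2\<^sub>1)\<close> are real on the circle and extend holomorphically to the
  disc: they are constant. Being also odd in \<open>\<zeta>\<close>, they vanish.\<close>

lemma unitary_plus_loop_diagonal: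
  assumes B: "B \<in> loop_plus_SL2" and SU2: "\<And>\<zeta>. \<zeta> \<in> sphere 0 1 \<Longrightarrow> B \<zeta> \<in> SU2"
    and \<zeta>: "\<zeta> \<in> sphere 0 1"
  shows "B \<zeta> $ 1 $ 2 = 0" and "B \<zeta> $ 2 $ 1 = 0"
proof -
  obtain G where contG: "continuous_on (cball 0 1) G"
    and holo: "\<And>i j. (\<lambda>\<zeta>. G \<zeta> $ i $ j) holomorphic_on ball 0 1"
    and GB: "\<And>\<zeta>. \<zeta> \<in> sphere 0 1 \<Longrightarrow> G \<zeta> = B \<zeta>"
    using B unfolding loop_plus_SL2_def by blast
  have cont: "continuous_on (cball 0 1) (\<lambda>\<zeta>. G \<zeta> $ i $ j)" for i j
    by (intro continuous_intros contG)
  have off: "G \<zeta> $ 2 $ 1 = - cnj (G \<zeta> $ 1 $ 2)" if "\<zeta> \<in> sphere 0 1" for \<zeta>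
    using SU2_entries(2)[OF SU2[OF that]] GB[OF that] by simp
  have const: "f constant_on cball 0 1"
    if "continuous_on (cball 0 1) f" "f holomorphic_on ball 0 1"
      "\<And>z. z \<in> sphere 0 1 \<Longrightarrow> f z \<in> \<real>" for f :: "complex \<Rightarrow> complex"
    using holomorphic_real_on_frontier_imp_constant[of "ball 0 1" f] that by simp
  have "(\<lambda>\<zeta>. G \<zeta> $ 1 $ 2 - G \<zeta> $ 2 $ 1) constant_on cball 0 1"
    by (rule const) (auto intro!: continuous_intros holomorphic_intros cont holo
        simp: off complex_is_Real_iff)
  moreover have "(\<lambda>\<zeta>. \<i> * (G \<zeta> $ 1 $ 2 + G \<zeta> $ 2 $ 1)) constant_on cball 0 1"
    by (rule const) (auto intro!: continuous_intros holomorphic_intros cont holo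
        simp: off complex_is_Real_iff)
  moreover have "\<zeta> \<in> cball 0 1" "- \<zeta> \<in> cball 0 1"
    using \<zeta> by auto
  ultimately have eq: "G (- \<zeta>) $ 1 $ 2 - G (- \<zeta>) $ 2 $ 1 = G \<zeta> $ 1 $ 2 - G \<zeta> $ 2 $ 1"
    "\<i> * (G (- \<zeta>) $ 1 $ 2 + G (- \<zeta>) $ 2 $ 1) = \<i> * (G \<zeta> $ 1 $ 2 + G \<zeta> $ 2 $ 1)"
    unfolding constant_on_def by metis+
  have "G (- \<zeta>) $ 1 $ 2 = - (G \<zeta> $ 1 $ 2)" "G (- \<zeta>) $ 2 $ 1 = - (G \<zeta> $ 2 $ 1)"
    using B \<zeta> GB by (auto simp: loop_plus_SL2_def loop_SL2_def twisted_def)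
  with eq have "G \<zeta> $ 1 $ 2 = 0 \<and> G \<zeta> $ 2 $ 1 = 0"
    by (simp add: complex_eq_iff)
  then show "B \<zeta> $ 1 $ 2 = 0" "B \<zeta> $ 2 $ 1 = 0"
    using GB[OF \<zeta>] by auto
qed

text \<open>Makes the DPW map explicit wherever \<open>X\<close> is unitary: in \<open>X = F B\<close> the factor \<open>B = F\<^sup>* X\<close> is
  then unitary, hence diagonal, and drops out of the conjugation of \<open>E3\<close>.\<close>

lemma iwasawa_of_unitary_loop:
  assumes iw: "iwasawa_decomposition X F B"
    and unitary: "\<And>\<zeta>. \<zeta> \<in> sphere 0 1 \<Longrightarrow> X \<zeta> ** adjoint_mat (X \<zeta>) = mat 1"
    and \<zeta>: "\<zeta> \<in> sphere 0 1"
  shows "Ad (F \<zeta>) E3 = X \<zeta> ** E3 ** adjoint_mat (X \<zeta>)"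
proof -
  have F: "F \<eta> ** adjoint_mat (F \<eta>) = mat 1" and X: "X \<eta> = F \<eta> ** B \<eta>"
    and detB: "det (B \<eta>) = 1" if "\<eta> \<in> sphere 0 1" for \<eta>
    using iw that
    by (auto simp: iwasawa_decomposition_def loop_SU2_def SU2_def loop_plus_SL2_def loop_SL2_def SL2C_def)
  have BSU2: "B \<eta> \<in> SU2" if \<eta>: "\<eta> \<in> sphere 0 1" for \<eta>
  proof -
    have "B \<eta> = (adjoint_mat (F \<eta>) ** F \<eta>) ** B \<eta>"
      by (simp add: unitary_left[OF F[OF \<eta>]])
    also have "\<dots> = adjoint_mat (F \<eta>) ** X \<eta>"
      by (simp add: X[OF \<eta>] matrix_mul_assoc)
    finally have "B \<eta> = adjoint_mat (F \<eta>) ** X \<eta>" .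
    then have "B \<eta> ** adjoint_mat (B \<eta>)
        = adjoint_mat (F \<eta>) ** (X \<eta> ** adjoint_mat (X \<eta>)) ** F \<eta>"
      by (simp add: adjoint_mat_mult matrix_mul_assoc)
    then show ?thesis
      using detB[OF \<eta>] by (simp add: SU2_def unitary[OF \<eta>] unitary_left[OF F[OF \<eta>]])
  qed
  have "B \<in> loop_plus_SL2"
    using iw by (simp add: iwasawa_decomposition_def)
  then have "B \<zeta> ** E3 = E3 ** B \<zeta>"
    using unitary_plus_loop_diagonal[of B \<zeta>] BSU2 \<zeta> by (simp add: E3_def mat2_entries)
  then have "B \<zeta> ** E3 ** adjoint_mat (B \<zeta>) = E3"
    using BSU2[OF \<zeta>] by (simp add: SU2_def flip: matrix_mul_assoc)
  moreover have "X \<zeta> ** E3 ** adjoint_mat (X \<zeta>)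
      = F \<zeta> ** (B \<zeta> ** E3 ** adjoint_mat (B \<zeta>)) ** adjoint_mat (F \<zeta>)"
    by (simp add: X[OF \<zeta>] adjoint_mat_mult matrix_mul_assoc)
  ultimately show ?thesis
    by (simp add: Ad_def matrix_inv_unitary[OF F[OF \<zeta>]])
qed

section \<open>Conjugation by a solution of the frame equation\<close>

text \<open>The derivative is taken entry by entry because the frame equation \<open>d\<Phi> = \<Phi> \<xi>\<close> is stated that
  way.\<close>

definition has_entrywise_derivative :: "(real \<Rightarrow> cmat2) \<Rightarrow> cmat2 \<Rightarrow> real filter \<Rightarrow> bool" where
  "has_entrywise_derivative M D F \<longleftrightarrow>
     (\<forall>i j. ((\<lambda>x. M x $ i $ j) has_vector_derivative D $ i $ j) F)"

lemma has_entrywise_derivative_mult: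
  assumes "has_entrywise_derivative M M' (at x within S)"
    and "has_entrywise_derivative L L' (at x within S)"
  shows "has_entrywise_derivative (\<lambda>x. M x ** L x) (M x ** L' + M' ** L x) (at x within S)"
proof -
  have "((\<lambda>x. M x $ i $ k * L x $ k $ j) has_vector_derivative
      (M x $ i $ k * L' $ k $ j + M' $ i $ k * L x $ k $ j)) (at x within S)" for i j k
    using assms unfolding has_entrywise_derivative_def
    by (intro has_vector_derivative_mult) auto
  then show ?thesis
    unfolding has_entrywise_derivative_def matrix_matrix_mult_def
    by (auto simp: simp flip: sum.distrib intro!: has_vector_derivative_sum)
qed

lemma has_entrywise_derivative_adjoint:
  assumes "has_entrywise_derivative M M' (at x within S)"
  shows "has_entrywise_derivative (\<lambda>x. adjoint_mat (M x)) (adjoint_mat M') (at x within S)"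
  using assms unfolding has_entrywise_derivative_def
  by (auto intro!: bounded_linear.has_vector_derivative[OF bounded_linear_cnj])

lemma has_entrywise_derivative_zero_imp_const:
  assumes "convex S" and "\<And>x. x \<in> S \<Longrightarrow> has_entrywise_derivative M 0 (at x within S)"
    and "x \<in> S" "y \<in> S"
  shows "M x = M y"
proof -
  have "M x $ i $ j = M y $ i $ j" for i j
    by (rule has_vector_derivative_zero_constant[OF assms(1), of "\<lambda>x. M x $ i $ j"])
      (use assms in \<open>auto simp: has_entrywise_derivative_def\<close>)
  then show ?thesis by (simp add: vec_eq_iff)
qed

text \<open>The product rule gives \<open>(\<Phi> X \<Phi>\<^sup>*)' = \<Phi> (A X + X' + X A\<^sup>*) \<Phi>\<^sup>*\<close>. With \<open>X = 1\<close> this is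
  conservation of unitarity for skew-Hermitian \<open>A\<close>; with \<open>X' = X A - A X\<close> it is conservation of
  the normal of the great circle.\<close>

lemma conjugate_by_frame_constant:
  fixes \<Phi> A X :: "real \<Rightarrow> cmat2"
  assumes "convex S"
    and \<Phi>: "\<And>x. x \<in> S \<Longrightarrow> has_entrywise_derivative \<Phi> (\<Phi> x ** A x) (at x within S)"
    and X: "\<And>x. x \<in> S \<Longrightarrow>
      has_entrywise_derivative X (- (A x ** X x + X x ** adjoint_mat (A x))) (at x within S)"
    and "x \<in> S" "y \<in> S"
  shows "\<Phi> x ** X x ** adjoint_mat (\<Phi> x) = \<Phi> y ** X y ** adjoint_mat (\<Phi> y)"
proof (rule has_entrywise_derivative_zero_imp_const[OF \<open>convex S\<close> _ \<open>x \<in> S\<close> \<open>y \<in> S\<close>])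
  fix x assume x: "x \<in> S"
  show "has_entrywise_derivative (\<lambda>x. \<Phi> x ** X x ** adjoint_mat (\<Phi> x)) 0 (at x within S)"
    using has_entrywise_derivative_mult[OF has_entrywise_derivative_mult[OF \<Phi>[OF x] X[OF x]]
        has_entrywise_derivative_adjoint[OF \<Phi>[OF x]]]
    by (rule back_subst[where P = "\<lambda>D. has_entrywise_derivative _ D _"])
      (simp add: mat2_entries algebra_simps)
qed

section \<open>The potential on the real line\<close>

lemma potential_skew_adjoint:
  assumes "\<kappa>1 z \<in> \<real>" "\<kappa>2 z \<in> \<real>" "\<kappa>3 z \<in> \<real>" and "\<zeta> \<in> sphere 0 1"
  shows "adjoint_mat (potential \<kappa>1 \<kappa>2 \<kappa>3 z \<zeta>) = - potential \<kappa>1 \<kappa>2 \<kappa>3 z \<zeta>"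
proof -
  have "inverse \<zeta> = cnj \<zeta>"
    using assms(4) by (metis complex_norm_square inverse_unique mem_sphere_0 of_real_1 power_one)
  then show ?thesis
    using assms(1-3) unfolding Reals_cnj_iff
    by (simp add: potential_def mat2_entries algebra_simps)
qed

text \<open>The matrix of the unit vector \<open>- cos t E1 - sin t E2\<close>. In this form its entries are
  exponentials, so that differentiation and conjugation by diagonal matrices act on them by
  multiplication.\<close>

definition equator_dir :: "real \<Rightarrow> cmat2" where
  "equator_dir t = mat2 0 (\<i>/2 * cis t) (\<i>/2 * cis (- t)) 0"

lemma potential_at_1:
  assumes "\<kappa>1 z = of_real (- v * cos t)" "\<kappa>2 z = of_real (- v * sin t)" "\<kappa>3 z = of_real (- d)"
  shows "potential \<kappa>1 \<kappa>2 \<kappa>3 z 1 = (- d) *\<^sub>R E3 + v *\<^sub>R equator_dir t"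
  by (simp add: assms potential_def E3_def equator_dir_def mat2_entries complex_eq_iff)

lemma E3_equator_dir_commutator:
  "E3 ** equator_dir t - equator_dir t ** E3
    = mat2 0 (\<i> * (\<i>/2 * cis t)) (- (\<i> * (\<i>/2 * cis (- t)))) 0"
  by (simp add: equator_dir_def E3_def mat2_entries complex_eq_iff)

text \<open>Bracketing with \<open>E3\<close> is the quarter turn in the plane of \<open>E1\<close> and \<open>E2\<close>, and the velocity of
  \<open>equator_dir (\<phi> x)\<close> is \<open>d\<close> times its quarter turn.\<close>

lemma has_entrywise_derivative_equator_dir:
  assumes "(\<phi> has_real_derivative d) (at x within S)"
  shows "has_entrywise_derivative (\<lambda>x. equator_dir (\<phi> x))
    (d *\<^sub>R (E3 ** equator_dir (\<phi> x) - equator_dir (\<phi> x) ** E3)) (at x within S)"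
proof -
  have "((\<lambda>x. \<i>/2 * cis (\<phi> x)) has_vector_derivative d *\<^sub>R (\<i> * (\<i>/2 * cis (\<phi> x))))
      (at x within S)"
    and "((\<lambda>x. \<i>/2 * cis (- \<phi> x)) has_vector_derivative d *\<^sub>R - (\<i> * (\<i>/2 * cis (- \<phi> x))))
      (at x within S)"
    using assms unfolding has_vector_derivative_complex_iff
    by (auto intro!: derivative_eq_intros)
  then show ?thesis
    unfolding has_entrywise_derivative_def E3_equator_dir_commutator
    by (simp add: forall_2 equator_dir_def)
qed

text \<open>At \<open>\<zeta> = 1\<close> the matrix \<open>R0 (t / 2)\<close> first turns \<open>equator_dir t\<close> about \<open>E3\<close> by the angle \<open>- t\<close>,
  onto \<open>- E1\<close>, and then turns \<open>- E1\<close> by a quarter turn about \<open>E2\<close> onto \<open>E3\<close>.\<close>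

lemma R0_equator_dir:
  "R0 (t / 2) 1 ** equator_dir t ** adjoint_mat (R0 (t / 2) 1) = E3"
proof -
  define r c where "r = complex_of_real (1 / sqrt 2)" and "c = cis (t / 2)"
  have "r * r = 1 / 2"
    by (simp add: r_def flip: of_real_mult)
  have "c * cnj c = 1"
    by (simp add: c_def cis_cnj cis_mult)
  have R0: "R0 (t / 2) 1 = mat2 (r * cnj c) (r * c) (- (r * cnj c)) (r * c)"
  proof -
    have "exp (\<i> * of_real (t / 2)) = c" "exp (- \<i> * of_real (t / 2)) = cnj c"
      by (simp_all add: c_def cis_cnj) (simp_all add: cis_conv_exp)
    then show ?thesis
      unfolding R0_def by (simp only:) (simp add: r_def mat2_entries complex_eq_iff)
  qed
  have dir: "equator_dir t = mat2 0 (\<i>/2 * (c * c)) (\<i>/2 * (cnj c * cnj c)) 0"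
    by (simp add: equator_dir_def c_def cis_cnj cis_mult)
  have "R0 (t / 2) 1 ** equator_dir t
      = mat2 (\<i>/2 * r * (c * cnj c) * cnj c) (\<i>/2 * r * (c * cnj c) * c)
             (\<i>/2 * r * (c * cnj c) * cnj c) (- (\<i>/2 * r * (c * cnj c) * c))"
    by (simp add: R0 dir mat2_entries)
  also have "\<dots> ** adjoint_mat (R0 (t / 2) 1)
      = mat2 (\<i> * (r * r) * (c * cnj c)) 0 0 (- (\<i> * (r * r) * (c * cnj c)))"
    unfolding \<open>c * cnj c = 1\<close>
    by (simp add: R0 mat2_entries r_def algebra_simps \<open>c * cnj c = 1\<close>)
  finally show ?thesis
    unfolding \<open>r * r = 1 / 2\<close> \<open>c * cnj c = 1\<close> by (simp add: E3_def)
qed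

theorem theorem5p3:
  fixes I :: "real set" and v \<phi> \<phi>' :: "real \<Rightarrow> real"
    and U :: "complex set" and \<kappa>1 \<kappa>2 \<kappa>3 :: "complex \<Rightarrow> complex"
    and \<Phi>0 :: "complex \<Rightarrow> complex^2^2" and N :: "complex \<Rightarrow> real^3"
  assumes "is_interval I" and "interior I \<noteq> {}" and "0 \<in> I"
    and "real_analytic_on v I" and "real_analytic_on \<phi> I"
    and "\<And>x. x \<in> I \<Longrightarrow> v x > 0"
    and "\<And>x. x \<in> I \<Longrightarrow> (\<phi> has_real_derivative \<phi>' x) (at x within I)"
    and "open U" and "simply_connected U" and "complex_of_real ` I \<subseteq> U"
    and "\<kappa>1 holomorphic_on U" and "\<kappa>2 holomorphic_on U" and "\<kappa>3 holomorphic_on U"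
    and "\<And>x. x \<in> I \<Longrightarrow> \<kappa>1 (complex_of_real x) = complex_of_real (- v x * cos (\<phi> x))"
    and "\<And>x. x \<in> I \<Longrightarrow> \<kappa>2 (complex_of_real x) = complex_of_real (- v x * sin (\<phi> x))"
    and "\<And>x. x \<in> I \<Longrightarrow> \<kappa>3 (complex_of_real x) = complex_of_real (- \<phi>' x)"
    and "\<Phi>0 \<in> loop_SU2"
    and "dpw_map U (potential \<kappa>1 \<kappa>2 \<kappa>3) \<Phi>0 N"
  shows "\<exists>C. great_circle C \<and> N ` (complex_of_real ` I) \<subseteq> C
           \<and> ((\<forall>\<zeta>\<in>sphere 0 1. \<Phi>0 \<zeta> = R0 (\<phi> 0 / 2) \<zeta>)
                \<longrightarrow> C \<subseteq> {p. p \<bullet> axis 3 1 = 0})"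
proof -
  obtain \<Phi> F B where sol: "solves_potential U (potential \<kappa>1 \<kappa>2 \<kappa>3) \<Phi>"
    and init: "\<And>\<zeta>. \<zeta> \<in> sphere 0 1 \<Longrightarrow> \<Phi> 0 \<zeta> = \<Phi>0 \<zeta>"
    and iw: "\<And>z. z \<in> U \<Longrightarrow> iwasawa_decomposition (\<Phi> z) (F z) (B z)"
    and N: "\<And>z. z \<in> U \<Longrightarrow> su2 (N z) = Ad (F z 1) E3"
    using assms(18) unfolding dpw_map_def by blast
  define A where "A = (\<lambda>x::real. potential \<kappa>1 \<kappa>2 \<kappa>3 (of_real x))"
  define \<Psi> where "\<Psi> = (\<lambda>x::real. \<Phi> (of_real x))"
  have "convex I"
    using assms(1) by (rule is_interval_convex)
  have U: "of_real x \<in> U" if "x \<in> I" for x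
    using assms(10) that by blast
  have frame: "has_entrywise_derivative (\<lambda>x. \<Psi> x \<zeta>) (\<Psi> x \<zeta> ** A x \<zeta>) (at x within I)"
    if "x \<in> I" "\<zeta> \<in> sphere 0 1" for x \<zeta>
    using sol U[OF that(1)] that(2)
    unfolding solves_potential_def has_entrywise_derivative_def \<Psi>_def A_def
    by (auto intro!: has_vector_derivative_real_field)
  have skew: "adjoint_mat (A x \<zeta>) = - A x \<zeta>" if "x \<in> I" "\<zeta> \<in> sphere 0 1" for x \<zeta>
    unfolding A_def using that assms(14-16) by (intro potential_skew_adjoint) auto
  have unitary: "\<Psi> x \<zeta> ** adjoint_mat (\<Psi> x \<zeta>) = mat 1" if x: "x \<in> I" and \<zeta>: "\<zeta> \<in> sphere 0 1" for x \<zeta>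
  proof -
    have "\<Psi> x \<zeta> ** mat 1 ** adjoint_mat (\<Psi> x \<zeta>) = \<Psi> 0 \<zeta> ** mat 1 ** adjoint_mat (\<Psi> 0 \<zeta>)"
    proof (rule conjugate_by_frame_constant[OF \<open>convex I\<close> frame[OF _ \<zeta>] _ x assms(3)])
      show "has_entrywise_derivative (\<lambda>x. mat 1)
          (- (A y \<zeta> ** mat 1 + mat 1 ** adjoint_mat (A y \<zeta>))) (at y within I)" if "y \<in> I" for y
        using skew[OF that \<zeta>] by (simp add: has_entrywise_derivative_def)
    qed
    also have "\<dots> = mat 1"
      using assms(17) \<zeta> init by (auto simp: \<Psi>_def loop_SU2_def SU2_def)
    finally show ?thesis
      by simp
  qed
  have N_frame: "su2 (N (of_real x)) = \<Psi> x 1 ** E3 ** adjoint_mat (\<Psi> x 1)" if "x \<in> I" for x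
    using N[OF U[OF that]] iwasawa_of_unitary_loop[OF iw[OF U[OF that]], of 1] unitary[OF that]
    by (simp add: \<Psi>_def)
  define X where "X = (\<lambda>x. equator_dir (\<phi> x))"
  define W where "W = \<Psi> 0 1 ** X 0 ** adjoint_mat (\<Psi> 0 1)"
  have W: "W = \<Psi> x 1 ** X x ** adjoint_mat (\<Psi> x 1)" if x: "x \<in> I" for x
    unfolding W_def
  proof (rule conjugate_by_frame_constant[OF \<open>convex I\<close> frame _ assms(3) x])
    fix y assume y: "y \<in> I"
    (* X commutes with the summand v X of A, so only the E3 part of A contributes. *)
    have A1: "A y 1 = (- \<phi>' y) *\<^sub>R E3 + v y *\<^sub>R X y"
      unfolding A_def X_def using y assms(14-16) by (intro potential_at_1) auto
    have "\<phi>' y *\<^sub>R (E3 ** X y - X y ** E3) = - (A y 1 ** X y + X y ** (- A y 1))"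
      unfolding A1 by (simp add: mat2_entries complex_eq_iff algebra_simps)
    also have "- A y 1 = adjoint_mat (A y 1)"
      using skew[OF y, of 1] by simp
    finally have "\<phi>' y *\<^sub>R (E3 ** X y - X y ** E3)
      = - (A y 1 ** X y + X y ** adjoint_mat (A y 1))" .
    then show "has_entrywise_derivative X (- (A y 1 ** X y + X y ** adjoint_mat (A y 1))) (at y within I)"
      using has_entrywise_derivative_equator_dir[OF assms(7)[OF y]] by (simp add: X_def)
  qed auto
  have X_skew: "adjoint_mat (X x) = - X x" for x
    by (simp add: X_def equator_dir_def mat2_entries cis_cnj)
  have X_X: "trace (X x ** X x) = - 1/2" for x
    by (simp add: X_def equator_dir_def trace_def mat2_entries cis_mult)
  have X_E3: "trace (X x ** E3) = 0" for x
    by (simp add: X_def equator_dir_def E3_def trace_def mat2_entries)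
  have "adjoint_mat W = - W"
    by (simp add: W_def adjoint_mat_conjugate X_skew conjugate_uminus)
  moreover have "trace W = 0"
  proof -
    have "trace W = trace (X 0)"
      using trace_conjugate_mult[OF unitary[OF assms(3)], of 1 "X 0" "mat 1"] unitary[OF assms(3), of 1]
      by (simp add: W_def)
    then show ?thesis by (simp add: X_def equator_dir_def trace_def sum_2)
  qed
  ultimately obtain n where n: "su2 n = W"
    by (rule su2_surj)
  define C where "C = {p \<in> sphere 0 1. n \<bullet> p = 0}"
  have "complex_of_real (n \<bullet> n) = of_real 1"
    using trace_conjugate_mult[OF unitary[OF assms(3)], of 1 "X 0" "X 0"] X_X
    by (simp only: inner_eq_trace_su2 n) (simp add: W_def)
  then have "n \<noteq> 0"
    by (metis inner_zero_left of_real_eq_iff zero_neq_one)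
  then have "great_circle C"
    by (auto simp: great_circle_def C_def)
  moreover have "N (of_real x) \<in> C" if x: "x \<in> I" for x
  proof -
    have "complex_of_real (N (of_real x) \<bullet> N (of_real x)) = of_real 1"
      using trace_conjugate_mult[OF unitary[OF x], of 1 E3 E3]
      by (simp only: inner_eq_trace_su2 N_frame[OF x]) (simp add: trace_def E3_def mat2_entries)
    moreover have "complex_of_real (n \<bullet> N (of_real x)) = of_real 0"
      using trace_conjugate_mult[OF unitary[OF x], of 1 "X x" E3] X_E3
      by (simp only: inner_eq_trace_su2 N_frame[OF x] n W[OF x]) simp
    ultimately show ?thesis
      by (simp only: of_real_eq_iff) (simp add: C_def norm_eq_1)
  qed
  moreover have "C \<subseteq> {p. p \<bullet> axis 3 1 = 0}" if "\<forall>\<zeta>\<in>sphere 0 1. \<Phi>0 \<zeta> = R0 (\<phi> 0 / 2) \<zeta>"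
  proof -
    have "W = E3"
      using R0_equator_dir[of "\<phi> 0"] that init[of 1] by (simp add: W_def X_def \<Psi>_def)
    then have "n = axis 3 1"
      using n by (simp add: su2_mat2 E3_def mat2_entries complex_eq_iff forall_3 axis_def)
    then show ?thesis
      by (auto simp: C_def inner_commute)
  qed
  ultimately show ?thesis by blast
qed

end
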